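(* Let $\rho:\mathbb{C}[[x,t]]\to\mathbb{C}[[x]]$ be the morphism of $\mathbb{C}$-algebras defined by $\rho\left(\sum_{i,j\geq 0}\alpha_{ij}x^it^j\right)=\sum_{i\geq 0}\alpha_{i0}x^i$. For every endomorphism $\phi$ of the $\mathbb{C}$-algebra $\mathbb{C}[[x,t]]$ such that $\rho\circ\phi=\rho$, there exist a unique $\mu\in\mathbb{C}[[x,t]]$ and a unique $\nu\in\mathbb{C}[[x,t]]$ such that $\phi=\phi_{\mu\nu}$.
   Context: For $\mu,\nu\in\mathbb{C}[[x,t]]$, $\phi_{\mu\nu}$ denotes the endomorphism of the $\mathbb{C}$-algebra $\mathbb{C}[[x,t]]$ such that $$\phi_{\mu\nu}(\alpha)=\sum_{i\geq 0}\frac{1}{i!}\frac{d^i\alpha}{dx^i}\mu^it^i=\alpha(x+\mu t)\quad\text{for every }\alpha\in\mathbb{C}[[x]],\qquad \phi_{\mu\nu}(t)=\nu t.$$ *)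

theory Defs
  imports "HOL-Computational_Algebra.Formal_Power_Series"
begin

text \<open>
  The algebra \<open>\<complex>[[x,t]]\<close> is rendered as \<open>\<complex>[[x]][[t]]\<close>: the outer variable is \<open>t\<close>, the
  coefficients are series in \<open>x\<close>, and \<open>\<complex>[[x]]\<close> is embedded by \<^const>\<open>fps_const\<close>.
\<close>

type_synonym series_x = "complex fps"
type_synonym series_xt = "complex fps fps"

abbreviation var_t :: series_xt where
  "var_t \<equiv> fps_X"

text \<open>The coefficient of \<open>x^i t^j\<close>; note the reversed order of extraction.\<close>

definition coeff_xt :: "series_xt \<Rightarrow> nat \<Rightarrow> nat \<Rightarrow> complex" where
  "coeff_xt f i j = fps_nth (fps_nth f j) i"

definition scale_xt :: "complex \<Rightarrow> series_xt \<Rightarrow> series_xt" where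
  "scale_xt c f = fps_const (fps_const c) * f"

text \<open>Endomorphisms are purely algebraic: no continuity is required.\<close>

definition alg_endo :: "(series_xt \<Rightarrow> series_xt) \<Rightarrow> bool" where
  "alg_endo \<phi> \<longleftrightarrow>
     \<phi> 1 = 1 \<and>
     (\<forall>f g. \<phi> (f + g) = \<phi> f + \<phi> g) \<and>
     (\<forall>f g. \<phi> (f * g) = \<phi> f * \<phi> g) \<and>
     (\<forall>c f. \<phi> (scale_xt c f) = scale_xt c (\<phi> f))"

definition rho :: "series_xt \<Rightarrow> series_x" where
  "rho f = Abs_fps (\<lambda>i. coeff_xt f i 0)"

text \<open>
  The series \<open>\<alpha>(x + \<mu> t)\<close>. The infinite sum is taken in the library's metric on formal power
  series, which on \<^typ>\<open>series_xt\<close> is the \<open>t\<close>-adic one; it converges because the \<open>i\<close>-th term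
  is divisible by \<open>t^i\<close>.
\<close>

definition taylor_shift :: "series_xt \<Rightarrow> series_x \<Rightarrow> series_xt" where
  "taylor_shift \<mu> \<alpha> =
     (\<Sum>i. scale_xt (1 / fact i) (fps_const ((fps_deriv ^^ i) \<alpha>) * \<mu> ^ i * var_t ^ i))"

text \<open>
  The description determines exactly one endomorphism: every algebra endomorphism of
  \<open>\<complex>[[x,t]]\<close> is local, hence continuous for the \<open>(x,t)\<close>-adic topology and determined by the
  images of \<open>x\<close> and \<open>t\<close>; substituting \<open>x + \<mu> t\<close> for \<open>x\<close> and \<open>\<nu> t\<close> for \<open>t\<close> gives existence.
\<close>

definition phi :: "series_xt \<Rightarrow> series_xt \<Rightarrow> series_xt \<Rightarrow> series_xt" where
  "phi \<mu> \<nu> = (THE \<phi>. alg_endo \<phi> \<and>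
     (\<forall>\<alpha>. \<phi> (fps_const \<alpha>) = taylor_shift \<mu> \<alpha>) \<and>
     \<phi> var_t = \<nu> * var_t)"

end

theory Submission
  imports Defs
begin

unbundle fps_syntax

text \<open>
  An endomorphism \<open>\<phi>\<close> with \<open>\<rho> \<circ> \<phi> = \<rho>\<close> fixes \<open>x\<close> and kills \<open>t\<close> modulo \<open>t\<close>, so it satisfies
  \<open>\<phi>(x) = x + \<mu> t\<close> and \<open>\<phi>(t) = \<nu> t\<close> for some \<open>\<mu>\<close> and \<open>\<nu>\<close>, and these are unique because \<open>\<complex>[[x,t]]\<close>
  is a domain. What has to be shown is that such data determine an endomorphism (although no
  continuity is assumed) and that they always come from one.

  Both rest on one device. If every \<open>d f\<close> is a multiple of \<open>p * d f'\<close>, where \<open>f'\<close> is what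
  remains of \<open>f\<close> after the constant term is removed and the variable is divided out, then every
  value of \<open>d\<close> is divisible by all powers of \<open>p\<close>. For \<open>p = t\<close> (\<open>fps_eq_0_if_X_powers_dvd\<close>) and
  for \<open>p = x + \<mu> t\<close> (\<open>eq_0_if_powers_dvd\<close>) this forces \<open>d = 0\<close>. With \<open>d\<close> a difference of two
  algebra maps one gets that they agree; with \<open>d f = \<Phi>(f g) - \<Phi>(f) \<Phi>(g)\<close> one gets that \<open>\<Phi>\<close> is
  multiplicative.

  The Taylor shift \<open>\<alpha> \<mapsto> \<alpha>(x + \<mu> t)\<close> is multiplicative because it is the Taylor homomorphism
  \<open>\<alpha> \<mapsto> \<Sum>\<^sub>i (d/dx)^i \<alpha> / i! * s^i\<close> followed by the substitution \<open>s := \<mu> t\<close>. It therefore agrees with \<open>\<phi>\<close> on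
  \<open>\<complex>[[x]]\<close> (\<open>alg_endo_eq_taylor_shift\<close>). Extending it \<open>t\<close>-adically by \<open>t \<mapsto> \<nu> t\<close> shows that the
  description of \<open>phi \<mu> \<nu>\<close> is satisfied by exactly one map (\<open>phi_unique_existence\<close>). This is
  needed for all \<open>\<mu>\<close> and \<open>\<nu>\<close>, not only for those read off from \<open>\<phi>\<close>: otherwise nothing would be
  known about a second pair with \<open>\<phi> = phi \<mu>' \<nu>'\<close>.
\<close>

section \<open>Elements divisible by all powers of an element\<close>

lemma power_dvd_by_descent:
  fixes d :: "'b \<Rightarrow> 'a :: comm_semiring_1"
  assumes "\<And>f. \<exists>c g. d f = c * p * d g"
  shows "p ^ n dvd d f"
proof (induction n arbitrary: f)
  case 0
  show ?case by simp
next
  case (Suc n)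
  obtain g c where "d f = c * p * d g" using assms by blast
  moreover have "p * p ^ n dvd p * d g" using Suc.IH by (intro mult_dvd_mono) auto
  ultimately show ?case by (simp add: mult.assoc)
qed

lemma fps_eq_0_if_X_powers_dvd:
  fixes h :: "'a :: comm_ring_1 fps"
  assumes "\<And>n. fps_X ^ n dvd h"
  shows "h = 0"
proof (rule fps_ext)
  fix n
  obtain g where "h = fps_X ^ Suc n * g" using assms by (meson dvdE)
  then show "h $ n = 0 $ n" by (simp add: fps_X_power_mult_nth del: power_Suc)
qed

text \<open>
  Over a domain, lowest coefficients multiply, and the lowest coefficient of \<open>p ^ n\<close> is \<open>x ^ n\<close> in
  degree 0. Hence the lowest coefficient of \<open>h\<close> is divisible by every power of \<open>x\<close>.
\<close>

lemma eq_0_if_powers_dvd: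
  fixes h p :: "'a :: idom fps fps"
  assumes p: "p $ 0 = fps_X" and dvd: "\<And>n. p ^ n dvd h"
  shows "h = 0"
proof -
  have "fps_X ^ n dvd h $ subdegree h" for n
  proof -
    obtain g where h: "h = p ^ n * g" using dvd by (meson dvdE)
    have "subdegree (p ^ n) = 0" by (rule subdegreeI) (simp_all add: p fps_power_zeroth)
    moreover have "p ^ n \<noteq> 0" using p by (metis fps_X_neq_zero fps_zero_nth power_not_zero)
    ultimately have "subdegree h = subdegree g"
      unfolding h by (cases "g = 0") simp_all
    moreover have "(p ^ n * g) $ subdegree g = fps_X ^ n * g $ subdegree g"
      by (simp add: p fps_power_zeroth)
    ultimately show ?thesis by (metis h dvd_triv_left)
  qed
  then have "h $ subdegree h = 0" by (rule fps_eq_0_if_X_powers_dvd)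
  then show ?thesis by simp
qed

lemma fps_split_constant_term:
  fixes f :: "'a :: comm_ring_1 fps"
  shows "f = fps_const (f $ 0) + fps_X * fps_shift 1 f"
  by (rule fps_ext) (auto simp: fps_mult_fps_X_commute)

section \<open>Infinite sums of multiples of powers\<close>

text \<open>
  The value of \<open>\<Sum>\<^sub>i a\<^sub>i u\<^sup>i\<close> for a series \<open>u\<close> without constant term. Unlike in \<^const>\<open>fps_compose\<close>,
  the coefficients \<open>a\<^sub>i\<close> may themselves involve the variable.
\<close>

definition power_series_sum :: "(nat \<Rightarrow> 'a :: comm_ring_1 fps) \<Rightarrow> 'a fps \<Rightarrow> 'a fps" where
  "power_series_sum a u = Abs_fps (\<lambda>n. (\<Sum>i\<le>n. a i * u ^ i) $ n)"

lemma power_series_sum_nth: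
  fixes u :: "'a :: comm_ring_1 fps"
  assumes "u $ 0 = 0" "n \<le> N"
  shows "power_series_sum a u $ n = (\<Sum>i\<le>N. a i * u ^ i) $ n"
proof -
  have "(a i * u ^ i) $ n = 0" if "n < i" for i
  proof -
    have "(u ^ i) $ k = 0" if "k \<le> n" for k
      using startsby_zero_power_prefix[OF assms(1), of i] that \<open>n < i\<close> by auto
    then show ?thesis by (auto simp: fps_mult_nth intro!: sum.neutral)
  qed
  then have "(\<Sum>i\<le>N. (a i * u ^ i) $ n) = (\<Sum>i\<le>n. (a i * u ^ i) $ n)"
    using assms(2) by (intro sum.mono_neutral_right) auto
  then show ?thesis by (simp add: power_series_sum_def fps_sum_nth)
qed

text \<open>This identifies the metric limits in the definition of the Taylor shift.\<close>

lemma power_series_sum_sums: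
  fixes u :: "'a :: comm_ring_1 fps"
  assumes "u $ 0 = 0"
  shows "(\<lambda>i. a i * u ^ i) sums power_series_sum a u"
  unfolding sums_def_le
proof (rule tendsto_fpsI)
  fix n
  show "\<forall>\<^sub>F N in sequentially. (\<Sum>i\<le>N. a i * u ^ i) $ n = power_series_sum a u $ n"
    using power_series_sum_nth[OF assms, of n _ a] by (intro eventually_sequentiallyI[of n]) simp
qed

lemma power_series_sum_split_head:
  fixes u :: "'a :: comm_ring_1 fps"
  assumes "u $ 0 = 0"
  shows "power_series_sum a u = a 0 + u * power_series_sum (\<lambda>i. a (Suc i)) u"
proof (rule fps_ext)
  fix n
  have "power_series_sum a u $ n = (\<Sum>i\<le>Suc n. a i * u ^ i) $ n"
    by (rule power_series_sum_nth) (simp_all add: assms)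
  also have "(\<Sum>i\<le>Suc n. a i * u ^ i) = a 0 + u * (\<Sum>i\<le>n. a (Suc i) * u ^ i)"
    by (subst sum.atMost_Suc_shift) (simp add: sum_distrib_left mult_ac)
  finally have "power_series_sum a u $ n = (a 0) $ n + (u * (\<Sum>i\<le>n. a (Suc i) * u ^ i)) $ n"
    by simp
  also have "(u * (\<Sum>i\<le>n. a (Suc i) * u ^ i)) $ n
      = (u * power_series_sum (\<lambda>i. a (Suc i)) u) $ n"
    by (simp add: fps_mult_nth power_series_sum_nth[OF assms, of _ n])
  finally show "power_series_sum a u $ n = (a 0 + u * power_series_sum (\<lambda>i. a (Suc i)) u) $ n"
    by simp
qed

lemma power_series_sum_const:
  "power_series_sum (\<lambda>i. fps_const (f $ i)) u = fps_compose f u"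
  by (rule fps_ext) (simp add: power_series_sum_def fps_compose_nth fps_sum_nth atMost_atLeast0)

section \<open>The Taylor shift\<close>

text \<open>The series \<open>\<alpha>(x + s)\<close>, with \<open>s\<close> as the outer variable.\<close>

definition taylor_hom :: "series_x \<Rightarrow> series_xt" where
  "taylor_hom \<alpha> = Abs_fps (\<lambda>i. fps_const (1 / fact i) * (fps_deriv ^^ i) \<alpha>)"

lemma taylor_hom_0 [simp]: "taylor_hom \<alpha> $ 0 = \<alpha>"
  by (simp add: taylor_hom_def)

lemma taylor_hom_deriv: "fps_deriv (taylor_hom \<alpha>) = taylor_hom (fps_deriv \<alpha>)"
proof (rule fps_ext)
  fix n
  have "of_nat (Suc n) * fps_const (1 / fact (Suc n)) = fps_const (1 / fact n :: complex)"
    by (simp del: of_nat_Suc flip: fps_of_nat)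
  then show "fps_deriv (taylor_hom \<alpha>) $ n = taylor_hom (fps_deriv \<alpha>) $ n"
    by (simp add: taylor_hom_def funpow_swap1 del: of_nat_Suc flip: mult.assoc)
qed

lemma funpow_fps_deriv_add:
  "(fps_deriv ^^ i) (\<alpha> + \<beta>) = (fps_deriv ^^ i) \<alpha> + (fps_deriv ^^ i) (\<beta> :: 'a :: comm_ring_1 fps)"
  by (induction i) simp_all

lemma funpow_fps_deriv_0: "(fps_deriv ^^ i) (0 :: 'a :: comm_ring_1 fps) = 0"
  by (induction i) simp_all

lemma taylor_hom_add: "taylor_hom (\<alpha> + \<beta>) = taylor_hom \<alpha> + taylor_hom \<beta>"
  by (rule fps_ext) (simp add: taylor_hom_def funpow_fps_deriv_add distrib_left)

text \<open>
  Both sides have the same constant term, and the same derivative by the product rule and the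
  statement for lower coefficients.
\<close>

lemma taylor_hom_mult: "taylor_hom (\<alpha> * \<beta>) = taylor_hom \<alpha> * taylor_hom \<beta>"
proof (rule fps_ext)
  fix n
  show "taylor_hom (\<alpha> * \<beta>) $ n = (taylor_hom \<alpha> * taylor_hom \<beta>) $ n"
  proof (induction n arbitrary: \<alpha> \<beta>)
    case 0
    show ?case by simp
  next
    case (Suc n)
    have "fps_deriv (taylor_hom (\<alpha> * \<beta>)) $ n = fps_deriv (taylor_hom \<alpha> * taylor_hom \<beta>) $ n"
      by (simp only: fps_deriv_mult taylor_hom_deriv taylor_hom_add fps_add_nth Suc.IH)
    then have "of_nat (n + 1) * taylor_hom (\<alpha> * \<beta>) $ (n + 1)
        = of_nat (n + 1) * (taylor_hom \<alpha> * taylor_hom \<beta>) $ (n + 1)"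
      by (simp only: fps_deriv_nth)
    then show ?case
      by (metis Suc_eq_plus1 mult_left_cancel of_nat_neq_0)
  qed
qed

lemma taylor_hom_const: "taylor_hom (fps_const c) = fps_const (fps_const c)"
proof (rule fps_ext)
  fix n
  have "(fps_deriv ^^ Suc m) (fps_const c) = 0" for m
    by (simp add: funpow_Suc_right funpow_fps_deriv_0 del: funpow.simps(2))
  then show "taylor_hom (fps_const c) $ n = fps_const (fps_const c) $ n"
    by (cases n) (simp_all add: taylor_hom_def del: funpow.simps(2))
qed

lemma taylor_hom_X: "taylor_hom fps_X = fps_const fps_X + fps_X"
proof (rule fps_ext)
  fix n
  have "(fps_deriv ^^ Suc (Suc m)) fps_X = (0 :: series_x)" for m
    by (simp add: funpow_Suc_right funpow_fps_deriv_0 del: funpow.simps(2))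
  then have high: "taylor_hom fps_X $ Suc (Suc m) = 0" for m
    by (simp add: taylor_hom_def del: funpow.simps(2))
  have one: "taylor_hom fps_X $ Suc 0 = 1" by (simp add: taylor_hom_def)
  consider "n = 0" | "n = Suc 0" | m where "n = Suc (Suc m)"
    by (metis nat.exhaust)
  then show "taylor_hom fps_X $ n = (fps_const fps_X + fps_X) $ n"
    by cases (simp_all add: high one)
qed

lemma taylor_shift_eq_compose:
  "taylor_shift \<mu> \<alpha> = fps_compose (taylor_hom \<alpha>) (\<mu> * var_t)"
proof -
  have "scale_xt (1 / fact i) (fps_const ((fps_deriv ^^ i) \<alpha>) * \<mu> ^ i * var_t ^ i)
      = fps_const (taylor_hom \<alpha> $ i) * (\<mu> * var_t) ^ i" for i
    by (simp add: scale_xt_def taylor_hom_def power_mult_distrib mult.assoc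
        flip: fps_const_mult)
  moreover have "(\<lambda>i. fps_const (taylor_hom \<alpha> $ i) * (\<mu> * var_t) ^ i) sums
      fps_compose (taylor_hom \<alpha>) (\<mu> * var_t)"
    using power_series_sum_sums[of "\<mu> * var_t"] by (simp flip: power_series_sum_const)
  ultimately show ?thesis
    by (simp add: taylor_shift_def sums_iff)
qed

lemma taylor_shift_add: "taylor_shift \<mu> (\<alpha> + \<beta>) = taylor_shift \<mu> \<alpha> + taylor_shift \<mu> \<beta>"
  by (simp add: taylor_shift_eq_compose taylor_hom_add fps_compose_add_distrib)

lemma taylor_shift_mult: "taylor_shift \<mu> (\<alpha> * \<beta>) = taylor_shift \<mu> \<alpha> * taylor_shift \<mu> \<beta>"
  by (simp add: taylor_shift_eq_compose taylor_hom_mult fps_compose_mult_distrib)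

lemma taylor_shift_const [simp]: "taylor_shift \<mu> (fps_const c) = fps_const (fps_const c)"
  by (simp add: taylor_shift_eq_compose taylor_hom_const)

lemma taylor_shift_0 [simp]: "taylor_shift \<mu> 0 = 0"
  using taylor_shift_const[of \<mu> 0] by simp

lemma taylor_shift_1 [simp]: "taylor_shift \<mu> 1 = 1"
  using taylor_shift_const[of \<mu> 1] by simp

lemma taylor_shift_X: "taylor_shift \<mu> fps_X = fps_const fps_X + \<mu> * var_t"
  by (simp add: taylor_shift_eq_compose taylor_hom_X fps_compose_add_distrib)

section \<open>Extending the Taylor shift to series in two variables\<close>

text \<open>The series \<open>f(x + \<mu> t, \<nu> t)\<close>.\<close>

definition subst_xt :: "series_xt \<Rightarrow> series_xt \<Rightarrow> series_xt \<Rightarrow> series_xt" where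
  "subst_xt \<mu> \<nu> f = power_series_sum (\<lambda>j. taylor_shift \<mu> (f $ j)) (\<nu> * var_t)"

lemma subst_xt_rec:
  "subst_xt \<mu> \<nu> f = taylor_shift \<mu> (f $ 0) + \<nu> * var_t * subst_xt \<mu> \<nu> (fps_shift 1 f)"
  unfolding subst_xt_def by (subst power_series_sum_split_head) simp_all

lemma subst_xt_add: "subst_xt \<mu> \<nu> (f + g) = subst_xt \<mu> \<nu> f + subst_xt \<mu> \<nu> g"
  by (rule fps_ext)
    (simp add: subst_xt_def power_series_sum_def taylor_shift_add distrib_right sum.distrib)

lemma subst_xt_0 [simp]: "subst_xt \<mu> \<nu> 0 = 0"
  using subst_xt_add[of \<mu> \<nu> 0 0] by simp

lemma subst_xt_const: "subst_xt \<mu> \<nu> (fps_const \<alpha>) = taylor_shift \<mu> \<alpha>"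
proof -
  have "fps_shift 1 (fps_const \<alpha>) = 0" by (rule fps_ext) simp
  then show ?thesis by (subst subst_xt_rec) simp
qed

lemma subst_xt_X_mult: "subst_xt \<mu> \<nu> (var_t * f) = \<nu> * var_t * subst_xt \<mu> \<nu> f"
proof -
  have "fps_shift 1 (var_t * f) = f" by (rule fps_ext) simp
  then show ?thesis by (subst subst_xt_rec) simp
qed

lemma subst_xt_const_mult:
  "subst_xt \<mu> \<nu> (fps_const \<alpha> * f) = taylor_shift \<mu> \<alpha> * subst_xt \<mu> \<nu> f"
proof -
  define d where "d g = subst_xt \<mu> \<nu> (fps_const \<alpha> * g) - taylor_shift \<mu> \<alpha> * subst_xt \<mu> \<nu> g" for g
  have "d g = \<nu> * var_t * d (fps_shift 1 g)" for g
  proof -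
    have "fps_shift 1 (fps_const \<alpha> * g) = fps_const \<alpha> * fps_shift 1 g"
      by (rule fps_ext) simp
    then show ?thesis
      unfolding d_def subst_xt_rec[of \<mu> \<nu> g] subst_xt_rec[of \<mu> \<nu> "fps_const \<alpha> * g"]
      by (simp add: taylor_shift_mult algebra_simps)
  qed
  then have "var_t ^ n dvd d f" for n
    by (intro power_dvd_by_descent) blast
  then have "d f = 0" by (rule fps_eq_0_if_X_powers_dvd)
  then show ?thesis by (simp add: d_def)
qed

lemma subst_xt_mult: "subst_xt \<mu> \<nu> (f * g) = subst_xt \<mu> \<nu> f * subst_xt \<mu> \<nu> g"
proof -
  define d where "d h = subst_xt \<mu> \<nu> (h * g) - subst_xt \<mu> \<nu> h * subst_xt \<mu> \<nu> g" for h
  have "d h = \<nu> * var_t * d (fps_shift 1 h)" for h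
  proof -
    have "h * g = fps_const (h $ 0) * g + var_t * (fps_shift 1 h * g)"
      by (subst fps_split_constant_term[of h]) (simp add: algebra_simps)
    then have "subst_xt \<mu> \<nu> (h * g) = taylor_shift \<mu> (h $ 0) * subst_xt \<mu> \<nu> g
        + \<nu> * var_t * subst_xt \<mu> \<nu> (fps_shift 1 h * g)"
      by (simp only: subst_xt_add subst_xt_const_mult subst_xt_X_mult)
    then show ?thesis
      unfolding d_def subst_xt_rec[of \<mu> \<nu> h] by (simp add: algebra_simps)
  qed
  then have "var_t ^ n dvd d f" for n
    by (intro power_dvd_by_descent) blast
  then have "d f = 0" by (rule fps_eq_0_if_X_powers_dvd)
  then show ?thesis by (simp add: d_def)
qed

lemma alg_endo_subst_xt: "alg_endo (subst_xt \<mu> \<nu>)"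
  unfolding alg_endo_def scale_xt_def
  using subst_xt_const[of \<mu> \<nu> 1]
  by (simp add: subst_xt_add subst_xt_mult subst_xt_const)

lemma subst_xt_X: "subst_xt \<mu> \<nu> var_t = \<nu> * var_t"
  using subst_xt_X_mult[of \<mu> \<nu> 1] alg_endo_subst_xt by (simp add: alg_endo_def)

section \<open>Endomorphisms are determined by the images of the variables\<close>

lemma alg_endo_split_constant_term:
  assumes "alg_endo \<phi>"
  shows "\<phi> f = \<phi> (fps_const (f $ 0)) + \<phi> var_t * \<phi> (fps_shift 1 f)"
  using assms fps_split_constant_term[of f] unfolding alg_endo_def by metis

lemma alg_endo_eqI:
  assumes endo: "alg_endo \<phi>" "alg_endo \<psi>"
    and const: "\<And>\<alpha>. \<phi> (fps_const \<alpha>) = \<psi> (fps_const \<alpha>)"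
    and t: "\<phi> var_t = \<nu> * var_t" "\<psi> var_t = \<nu> * var_t"
  shows "\<phi> = \<psi>"
proof
  fix f
  have "\<phi> g - \<psi> g = \<nu> * var_t * (\<phi> (fps_shift 1 g) - \<psi> (fps_shift 1 g))" for g
    using endo[THEN alg_endo_split_constant_term, of g]
    by (simp add: const t algebra_simps)
  then have "var_t ^ n dvd \<phi> f - \<psi> f" for n
    by (intro power_dvd_by_descent[where d = "\<lambda>f. \<phi> f - \<psi> f"]) blast
  then have "\<phi> f - \<psi> f = 0" by (rule fps_eq_0_if_X_powers_dvd)
  then show "\<phi> f = \<psi> f" by simp
qed

text \<open>
  On \<open>\<complex>[[x]]\<close> both maps send \<open>\<alpha> = c + x \<alpha>'\<close> to \<open>c + (x + \<mu> t)\<close> times the image of \<open>\<alpha>'\<close>, so their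
  difference is divisible by all powers of \<open>x + \<mu> t\<close>.
\<close>

lemma alg_endo_eq_taylor_shift:
  assumes endo: "alg_endo \<phi>" and x: "\<phi> (fps_const fps_X) = fps_const fps_X + \<mu> * var_t"
  shows "\<phi> (fps_const \<alpha>) = taylor_shift \<mu> \<alpha>"
proof -
  let ?p = "fps_const fps_X + \<mu> * var_t"
  define d where "d \<beta> = \<phi> (fps_const \<beta>) - taylor_shift \<mu> \<beta>" for \<beta>
  have scalar: "\<phi> (fps_const (fps_const c)) = fps_const (fps_const c)" for c
    using endo unfolding alg_endo_def scale_xt_def by (metis mult.right_neutral)
  have "d \<beta> = 1 * ?p * d (fps_shift 1 \<beta>)" for \<beta>
  proof -
    have "fps_const \<beta> = fps_const (fps_const (\<beta> $ 0)) + fps_const fps_X * fps_const (fps_shift 1 \<beta>)"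
      using fps_split_constant_term[of \<beta>] by (metis fps_const_add fps_const_mult)
    then have "\<phi> (fps_const \<beta>) = fps_const (fps_const (\<beta> $ 0)) + ?p * \<phi> (fps_const (fps_shift 1 \<beta>))"
      using endo unfolding alg_endo_def by (metis scalar x)
    moreover have "taylor_shift \<mu> \<beta>
        = fps_const (fps_const (\<beta> $ 0)) + ?p * taylor_shift \<mu> (fps_shift 1 \<beta>)"
      by (subst fps_split_constant_term[of \<beta>])
        (simp only: taylor_shift_add taylor_shift_mult taylor_shift_X taylor_shift_const)
    ultimately show ?thesis by (simp add: d_def algebra_simps)
  qed
  then have "?p ^ n dvd d \<alpha>" for n
    by (intro power_dvd_by_descent) blast
  then have "d \<alpha> = 0" by (intro eq_0_if_powers_dvd[of ?p]) simp_all
  then show ?thesis by (simp add: d_def)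
qed

section \<open>The endomorphisms compatible with reduction modulo t\<close>

lemma phi_unique_existence:
  "\<exists>!\<phi>. alg_endo \<phi> \<and> (\<forall>\<alpha>. \<phi> (fps_const \<alpha>) = taylor_shift \<mu> \<alpha>) \<and> \<phi> var_t = \<nu> * var_t"
proof (rule ex1I[of _ "subst_xt \<mu> \<nu>"])
  show "alg_endo (subst_xt \<mu> \<nu>) \<and> (\<forall>\<alpha>. subst_xt \<mu> \<nu> (fps_const \<alpha>) = taylor_shift \<mu> \<alpha>)
      \<and> subst_xt \<mu> \<nu> var_t = \<nu> * var_t"
    by (simp add: alg_endo_subst_xt subst_xt_const subst_xt_X)
next
  fix \<psi>
  assume "alg_endo \<psi> \<and> (\<forall>\<alpha>. \<psi> (fps_const \<alpha>) = taylor_shift \<mu> \<alpha>) \<and> \<psi> var_t = \<nu> * var_t"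
  then show "\<psi> = subst_xt \<mu> \<nu>"
    by (intro alg_endo_eqI) (auto simp: alg_endo_subst_xt subst_xt_const subst_xt_X)
qed

lemma phi_const: "phi \<mu> \<nu> (fps_const \<alpha>) = taylor_shift \<mu> \<alpha>"
  and phi_t: "phi \<mu> \<nu> var_t = \<nu> * var_t"
  using theI'[OF phi_unique_existence[of \<mu> \<nu>]] by (simp_all add: phi_def)

lemma phi_eqI:
  assumes "alg_endo \<phi>" "\<And>\<alpha>. \<phi> (fps_const \<alpha>) = taylor_shift \<mu> \<alpha>" "\<phi> var_t = \<nu> * var_t"
  shows "phi \<mu> \<nu> = \<phi>"
  unfolding phi_def using the1_equality[OF phi_unique_existence] assms by blast

lemma phi_inject:
  assumes "phi \<mu> \<nu> = phi \<mu>' \<nu>'"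
  shows "\<mu> = \<mu>'" and "\<nu> = \<nu>'"
proof -
  have "taylor_shift \<mu> fps_X = taylor_shift \<mu>' fps_X"
    using assms by (metis phi_const)
  then show "\<mu> = \<mu>'" by (simp add: taylor_shift_X)
  have "\<nu> * var_t = \<nu>' * var_t" using assms by (metis phi_t)
  then show "\<nu> = \<nu>'" by simp
qed

lemma rho_eq_nth_0: "rho f = f $ 0"
  by (rule fps_ext) (simp add: rho_def coeff_xt_def)

theorem mainTheorem3:
  fixes \<phi> :: "series_xt \<Rightarrow> series_xt"
  assumes "alg_endo \<phi>"
    and "rho \<circ> \<phi> = rho"
  shows "\<exists>!(\<mu>, \<nu>). \<phi> = phi \<mu> \<nu>"
proof -
  have rho: "\<phi> f $ 0 = f $ 0" for f
    using fun_cong[OF assms(2), of f] by (simp add: rho_eq_nth_0)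
  define \<mu> where "\<mu> = fps_shift 1 (\<phi> (fps_const fps_X))"
  define \<nu> where "\<nu> = fps_shift 1 (\<phi> var_t)"
  have x: "\<phi> (fps_const fps_X) = fps_const fps_X + \<mu> * var_t"
    using fps_split_constant_term[of "\<phi> (fps_const fps_X)"] by (simp add: rho \<mu>_def mult.commute)
  have t: "\<phi> var_t = \<nu> * var_t"
    using fps_split_constant_term[of "\<phi> var_t"] by (simp add: rho \<nu>_def mult.commute)
  have "phi \<mu> \<nu> = \<phi>"
    using assms(1) alg_endo_eq_taylor_shift[OF assms(1) x] t by (rule phi_eqI)
  then show ?thesis
    by (intro ex1I[of _ "(\<mu>, \<nu>)"]) (auto dest: phi_inject)
qed

end
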